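(* Let $B$ and $C$ be linear endomorphisms of $V$ with $B=B^*$ and $C=-C^*$, and let $\dim V>3$. Assume that every proper subset (subfamily) of $\{R^S_I, R^S_B, R^{\Lambda}_C\}$ is linearly independent. If $\{I,B,C\}$ is linearly independent, then $\{R^S_{I}, R^S_{B}, R^{\Lambda}_{C}\}$ is linearly independent.
   Context: $V$ is a finite-dimensional real vector space, $\phi$ a positive definite inner product on $V$, $A^*$ the adjoint of $A$ with respect to $\phi$, and $I$ the identity endomorphism. For an endomorphism $A$ of $V$, $$R^S_{A}(x,y,z,w)= \phi (Ax,w) \phi (Ay,z) - \phi (Ax,z) \phi (Ay,w),$$ $$R^{\Lambda}_{A} (x,y,z,w) =\phi (Ax,w) \phi (Ay,z) - \phi (Ax,z) \phi (Ay,w) -2 \phi (Ax,y) \phi (Az,w).$$ Linear independence of tensors is in the real vector space of multilinear maps $V^4\to\mathbb{R}$; sets are regarded as indexed families. *)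

theory Defs
  imports "HOL-Analysis.Analysis" "HOL-Library.Function_Algebras"
begin

text \<open>
  Real-valued functions of four arguments form a real vector space under pointwise operations; the
  multilinear maps are a subspace of it, so that linear independence may be tested in either space.
  The same instance makes the endomorphisms a subspace of the space of self-maps.
\<close>

instantiation "fun" :: (type, real_vector) real_vector
begin

definition scaleR_fun :: "real \<Rightarrow> ('a \<Rightarrow> 'b) \<Rightarrow> 'a \<Rightarrow> 'b"
  where "scaleR_fun c f = (\<lambda>x. c *\<^sub>R f x)"

instance
  by standard (auto simp: scaleR_fun_def fun_eq_iff scaleR_add_right scaleR_add_left)

end

text \<open>
  Linear independence of an indexed family: repeated members make it dependent, although
  they collapse in the underlying set.
\<close>

definition independent_family :: "'i set \<Rightarrow> ('i \<Rightarrow> 'v::real_vector) \<Rightarrow> bool"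
  where "independent_family J v \<longleftrightarrow> inj_on v J \<and> independent (v ` J)"

lemma independent_family_iff:
  assumes "finite J"
  shows "independent_family J v \<longleftrightarrow>
    (\<forall>c. (\<Sum>i\<in>J. c i *\<^sub>R v i) = 0 \<longrightarrow> (\<forall>i\<in>J. c i = 0))"
proof
  assume L: "independent_family J v"
  show "\<forall>c. (\<Sum>i\<in>J. c i *\<^sub>R v i) = 0 \<longrightarrow> (\<forall>i\<in>J. c i = 0)"
  proof (intro allI impI ballI)
    fix c i assume s: "(\<Sum>i\<in>J. c i *\<^sub>R v i) = 0" and i: "i \<in> J"
    have inj: "inj_on v J" and ind: "independent (v ` J)"
      using L by (auto simp: independent_family_def)
    have "(\<Sum>x\<in>v ` J. c (inv_into J v x) *\<^sub>R x) = (\<Sum>i\<in>J. c i *\<^sub>R v i)"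
      using inj by (simp add: sum.reindex)
    then have "c (inv_into J v (v i)) = 0"
      using ind s i assms by (auto simp: dependent_finite)
    then show "c i = 0" using inj i by simp
  qed
next
  assume R: "\<forall>c. (\<Sum>i\<in>J. c i *\<^sub>R v i) = 0 \<longrightarrow> (\<forall>i\<in>J. c i = 0)"
  have inj: "inj_on v J"
  proof (rule inj_onI, rule ccontr)
    fix i j assume ij: "i \<in> J" "j \<in> J" "v i = v j" "i \<noteq> j"
    let ?c = "\<lambda>k. (if k = i then 1 else 0) - (if k = j then 1 else (0::real))"
    have "(\<Sum>k\<in>J. ?c k *\<^sub>R v k) = 
      (\<Sum>k\<in>J. if k = i then v k else 0) - (\<Sum>k\<in>J. if k = j then v k else 0)"
      by (auto simp: sum_subtractf[symmetric] scaleR_diff_left intro!: sum.cong)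
    also have "\<dots> = 0" using ij assms by simp
    finally have "?c i = 0" using R[rule_format, of ?c, OF _ ij(1)] by blast
    with ij show False by simp
  qed
  have "independent (v ` J)"
    using R assms inj by (auto simp: dependent_finite sum.reindex)
  with inj show "independent_family J v" by (simp add: independent_family_def)
qed

definition R_S :: "('a::real_inner \<Rightarrow> 'a) \<Rightarrow> 'a \<Rightarrow> 'a \<Rightarrow> 'a \<Rightarrow> 'a \<Rightarrow> real"
  where "R_S A x y z w = (A x \<bullet> w) * (A y \<bullet> z) - (A x \<bullet> z) * (A y \<bullet> w)"

definition R_Lambda :: "('a::real_inner \<Rightarrow> 'a) \<Rightarrow> 'a \<Rightarrow> 'a \<Rightarrow> 'a \<Rightarrow> 'a \<Rightarrow> real"
  where "R_Lambda A x y z w =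
    (A x \<bullet> w) * (A y \<bullet> z) - (A x \<bullet> z) * (A y \<bullet> w) - 2 * (A x \<bullet> y) * (A z \<bullet> w)"

end

theory Submission
  imports Defs
begin

text \<open>
  Suppose that \<open>\<alpha> R\<^sup>S\<^sub>I + \<beta> R\<^sup>S\<^sub>B + \<gamma> R\<^sup>\<Lambda>\<^sub>C = 0\<close> is a nontrivial relation.  Independence of the two pairs
  containing \<open>R\<^sup>S\<^sub>B\<close> forces \<open>\<alpha> \<noteq> 0\<close> and \<open>\<gamma> \<noteq> 0\<close>.  Evaluate the relation on an orthonormal eigenbasis
  of \<open>B\<close> (lemma \<open>selfadjoint_orthonormal_eigenbasis\<close>) with eigenvalues \<open>\<lambda>\<^sub>i\<close>, and put
  \<open>c\<^sub>i\<^sub>j = \<phi>(C e\<^sub>i, e\<^sub>j)\<close>.  There the two symmetric tensors live only on index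
  patterns with two distinct indices, each used twice, so the remaining components restrict \<open>C\<close> alone:
  \<^item> the components \<open>(i,j,k,i)\<close> with distinct indices give \<open>c\<^sub>i\<^sub>j c\<^sub>i\<^sub>k = 0\<close>, so that each row of \<open>C\<close>
    has at most one nonzero entry;
  \<^item> the components with four distinct indices then show that \<open>c\<^sub>p\<^sub>q \<noteq> 0\<close> forces
    \<open>c\<^sub>r\<^sub>s = 0\<close> whenever \<open>r\<close> and \<open>s\<close> differ from \<open>p\<close> and \<open>q\<close>;
  \<^item> the components \<open>(i,j,j,i)\<close> give \<open>\<alpha> + \<beta> \<lambda>\<^sub>i \<lambda>\<^sub>j + 3 \<gamma> c\<^sub>i\<^sub>j\<^sup>2 = 0\<close>.

  The map \<open>C\<close>, as a member of an independent family, is nonzero, so some \<open>c\<^sub>p\<^sub>q\<close> is nonzero,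
  and \<open>dim V > 3\<close> provides two more basis vectors \<open>r\<close>, \<open>s\<close>.
  All pairs from \<open>p, q, r, s\<close> other than \<open>{p, q}\<close> then have the same product
  \<open>\<lambda>\<^sub>i \<lambda>\<^sub>j = - \<alpha> / \<beta> \<noteq> 0\<close>.  Hence \<open>\<lambda>\<^sub>p = \<lambda>\<^sub>q = \<lambda>\<^sub>r\<close>, so \<open>\<lambda>\<^sub>p \<lambda>\<^sub>q\<close> has that value too and
  \<open>c\<^sub>p\<^sub>q = 0\<close>, a contradiction.
\<close>

section \<open>Orthonormal eigenbases of self-adjoint maps\<close>

text \<open>
  A nonnegative function of \<open>t\<close> that vanishes at \<open>t = 0\<close> has a minimum there, so its derivative
  \<open>2 k\<close> at that point is zero.
\<close>

lemma linear_coefficient_zero_if_nonneg: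
  fixes k q :: real
  assumes "\<And>t. 0 \<le> 2 * t * k + t\<^sup>2 * q" and "0 \<le> q"
  shows "k = 0"
proof -
  \<comment> \<open>The minimiser is \<open>t = - k / q\<close>; the shift by 1 also covers \<open>q = 0\<close> and still gives a negative value
     unless \<open>k = 0\<close>.\<close>
  have "0 \<le> (2 * (- k / (q + 1)) * k + (- k / (q + 1))\<^sup>2 * q) * (q + 1)\<^sup>2"
    using assms(1)[of "- k / (q + 1)"] by simp
  also have "\<dots> = - (k\<^sup>2 * (q + 2))"
  proof -
    have "- k / (q + 1) * (q + 1) = - k" using assms(2) by simp
    then show ?thesis by algebra
  qed
  finally have "k\<^sup>2 * (q + 2) \<le> 0" by simp
  with assms(2) show "k = 0"
    by (smt (verit) mult_pos_pos zero_less_power2)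
qed

text \<open>
  A maximiser \<open>v\<close> of the Rayleigh quotient on the unit sphere of \<open>S\<close> is an eigenvector: with \<open>m\<close> the
  maximum, the quadratic form \<open>m |x|\<^sup>2 - \<langle>B x, x\<rangle>\<close> is nonnegative on \<open>S\<close> and vanishes at \<open>v\<close>, hence
  \<open>v\<close> lies in its radical, that is, \<open>m v - B v\<close> is orthogonal to \<open>S\<close>.
\<close>

lemma selfadjoint_eigenvector_in_subspace:
  fixes B :: "'a::euclidean_space \<Rightarrow> 'a"
  assumes B: "linear B" and sym: "\<And>x y. B x \<bullet> y = x \<bullet> B y"
    and S: "subspace S" and inv: "\<And>x. x \<in> S \<Longrightarrow> B x \<in> S" and ne: "S \<noteq> {0}"
  obtains v m where "v \<in> S" "norm v = 1" "B v = m *\<^sub>R v"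
proof -
  obtain s where s: "s \<in> S" "s \<noteq> 0"
    using ne subspace_0[OF S] by blast
  have "s /\<^sub>R norm s \<in> S \<inter> sphere 0 1"
    using s S by (simp add: subspace_scale)
  then have nonempty: "S \<inter> sphere 0 1 \<noteq> {}" by blast
  have "compact (S \<inter> sphere 0 1)"
    by (simp add: closed_Int_compact closed_subspace S)
  moreover have "continuous_on (S \<inter> sphere 0 1) (\<lambda>x. B x \<bullet> x)"
    using B by (intro continuous_intros linear_continuous_on) (simp add: linear_conv_bounded_linear)
  ultimately obtain v where v: "v \<in> S" "norm v = 1"
    and max: "\<And>x. x \<in> S \<Longrightarrow> norm x = 1 \<Longrightarrow> B x \<bullet> x \<le> B v \<bullet> v"
    using continuous_attains_sup[OF _ nonempty] by fastforce
  define m where "m = B v \<bullet> v"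
  have form_nonneg: "0 \<le> m * (x \<bullet> x) - B x \<bullet> x" if x: "x \<in> S" for x
  proof (cases "x = 0")
    case True
    then show ?thesis by simp
  next
    case False
    have "B (x /\<^sub>R norm x) \<bullet> (x /\<^sub>R norm x) \<le> m"
      unfolding m_def using x False S by (intro max) (auto simp: subspace_scale)
    moreover have "B (x /\<^sub>R norm x) \<bullet> (x /\<^sub>R norm x) = (B x \<bullet> x) / (x \<bullet> x)"
      by (simp only: linear_scale[OF B] inner_scaleR_left inner_scaleR_right dot_square_norm)
        (simp add: power2_eq_square divide_inverse)
    ultimately have "(B x \<bullet> x) / (x \<bullet> x) \<le> m" by simp
    then show ?thesis
      using False by (simp add: pos_divide_le_eq)
  qed
  have orth: "(m *\<^sub>R v - B v) \<bullet> u = 0" if u: "u \<in> S" for u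
  proof (rule linear_coefficient_zero_if_nonneg)
    show "0 \<le> m * (u \<bullet> u) - B u \<bullet> u" using form_nonneg[OF u] .
    fix t :: real
    have "v + t *\<^sub>R u \<in> S" using u v S by (simp add: subspace_add subspace_scale)
    from form_nonneg[OF this]
    have "0 \<le> m * ((v + t *\<^sub>R u) \<bullet> (v + t *\<^sub>R u)) - B (v + t *\<^sub>R u) \<bullet> (v + t *\<^sub>R u)" .
    also have "\<dots> = 2 * t * ((m *\<^sub>R v - B v) \<bullet> u) + t\<^sup>2 * (m * (u \<bullet> u) - B u \<bullet> u)"
    proof -
      have "v \<bullet> v = 1" "B u \<bullet> v = B v \<bullet> u" "u \<bullet> v = v \<bullet> u"
        using v(2) sym[of u v] by (auto simp: dot_square_norm inner_commute)
      then show ?thesis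
        using B by (simp add: linear_add linear_scale inner_simps m_def[symmetric]
            power2_eq_square algebra_simps)
    qed
    finally show "0 \<le> 2 * t * ((m *\<^sub>R v - B v) \<bullet> u) + t\<^sup>2 * (m * (u \<bullet> u) - B u \<bullet> u)" .
  qed
  have "m *\<^sub>R v - B v \<in> S"
    using v inv S by (simp add: subspace_diff subspace_scale)
  from orth[OF this] have "B v = m *\<^sub>R v" by simp
  with v that show ?thesis by blast
qed

text \<open>
  Split off one unit eigenvector; its orthogonal complement inside \<open>S\<close> is again invariant because
  \<open>B\<close> is self-adjoint, and it has smaller dimension.
\<close>

lemma selfadjoint_orthonormal_eigenbasis_subspace:
  fixes B :: "'a::euclidean_space \<Rightarrow> 'a"
  assumes B: "linear B" and sym: "\<And>x y. B x \<bullet> y = x \<bullet> B y"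
    and "subspace S" and "\<And>x. x \<in> S \<Longrightarrow> B x \<in> S"
  shows "\<exists>E \<subseteq> S. pairwise orthogonal E \<and> (\<forall>e\<in>E. norm e = 1 \<and> (\<exists>m. B e = m *\<^sub>R e)) \<and> span E = S"
  using assms(3,4)
proof (induction "dim S" arbitrary: S rule: less_induct)
  case less
  note S = \<open>subspace S\<close> and inv = less.prems(2)
  show ?case
  proof (cases "S = {0}")
    case True
    then show ?thesis by (intro exI[of _ "{}"]) auto
  next
    case False
    obtain v m where v: "v \<in> S" "norm v = 1" "B v = m *\<^sub>R v"
      using selfadjoint_eigenvector_in_subspace[OF B sym S inv False] by blast
    have vv: "v \<bullet> v = 1" using v(2) by (simp add: dot_square_norm)
    define T where "T = {x \<in> S. v \<bullet> x = 0}"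
    have T: "subspace T"
      using S unfolding T_def subspace_def by (auto simp: inner_simps)
    have T_inv: "B x \<in> T" if "x \<in> T" for x
      using that inv sym[of v x] v(3) by (auto simp: T_def)
    have "v \<notin> T" using vv by (simp add: T_def)
    then have "T \<subset> S" using v(1) T_def by blast
    then have "dim T < dim S"
      using S T dim_psubset[of T S] by (simp add: span_eq_iff[THEN iffD2])
    from less.hyps[OF this T T_inv] obtain E where E: "E \<subseteq> T" "pairwise orthogonal E"
      "\<forall>e\<in>E. norm e = 1 \<and> (\<exists>m. B e = m *\<^sub>R e)" "span E = T" by blast
    have "span (insert v E) = S"
    proof
      have "insert v E \<subseteq> S" using v(1) E(1) by (auto simp: T_def)
      then show "span (insert v E) \<subseteq> S" using S by (rule span_minimal)
      show "S \<subseteq> span (insert v E)"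
      proof
        fix x assume x: "x \<in> S"
        have "x - (v \<bullet> x) *\<^sub>R v \<in> T"
          using x v(1) S vv by (auto simp: T_def subspace_diff subspace_scale inner_simps)
        then show "x \<in> span (insert v E)"
          using E(4) by (auto simp: span_insert)
      qed
    qed
    moreover have "pairwise orthogonal (insert v E)"
      using E(1,2) by (auto simp: pairwise_insert T_def orthogonal_def inner_commute)
    ultimately show ?thesis
      using v E \<open>T \<subset> S\<close> by (intro exI[of _ "insert v E"]) auto
  qed
qed

lemma selfadjoint_orthonormal_eigenbasis:
  fixes B :: "'a::euclidean_space \<Rightarrow> 'a"
  assumes "linear B" and "\<And>x y. B x \<bullet> y = x \<bullet> B y"
  obtains E l where "pairwise orthogonal E" "\<And>e. e \<in> E \<Longrightarrow> norm e = 1"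
    "\<And>e. e \<in> E \<Longrightarrow> B e = l e *\<^sub>R e" "span E = UNIV" "finite E" "card E = DIM('a)"
proof -
  obtain E where E: "pairwise orthogonal E" "span E = UNIV"
    "\<forall>e\<in>E. norm e = 1 \<and> (\<exists>m. B e = m *\<^sub>R e)"
    using selfadjoint_orthonormal_eigenbasis_subspace[OF assms, of UNIV] by auto
  then obtain l where "\<forall>e\<in>E. B e = l e *\<^sub>R e" by metis
  moreover have "independent E"
    using E by (intro pairwise_orthogonal_independent) auto
  ultimately show ?thesis
    using that[of E l] E dim_eq_card[of E UNIV] independent_bound[of E] by auto
qed

section \<open>Components of the relation on the eigenbasis\<close>

text \<open>
  Two vectors \<open>r\<close>, \<open>s\<close> outside the plane of \<open>p\<close>, \<open>q\<close> are what makes the argument work: the products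
  of eigenvalues over the pairs \<open>{p,r}\<close>, \<open>{p,s}\<close>, \<open>{q,r}\<close>, \<open>{q,s}\<close>, \<open>{r,s}\<close> determine the one over
  \<open>{p,q}\<close>.  If \<open>\<alpha>\<close> were zero, the conclusion would fail: \<open>B\<close> could be a projection onto the plane of
  \<open>p\<close>, \<open>q\<close> and \<open>C\<close> a quarter turn of that plane, extended by zero.
\<close>

lemma curvature_relation_forces_skew_entry_zero:
  fixes B C :: "'a::real_inner \<Rightarrow> 'a"
  assumes rel: "\<And>x y z w. \<alpha> * R_S id x y z w + \<beta> * R_S B x y z w + \<gamma> * R_Lambda C x y z w = 0"
    and nz: "\<alpha> \<noteq> 0" "\<gamma> \<noteq> 0"
    and skew: "\<And>x y. C x \<bullet> y = - (C y \<bullet> x)"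
    and orth: "pairwise orthogonal E" and unit: "\<And>e. e \<in> E \<Longrightarrow> norm e = 1"
    and eig: "\<And>e. e \<in> E \<Longrightarrow> B e = l e *\<^sub>R e"
    and mem: "{p, q, r, s} \<subseteq> E" and dist: "distinct [p, q, r, s]"
  shows "C p \<bullet> q = 0"
proof (rule ccontr)
  assume pq: "C p \<bullet> q \<noteq> 0"
  have ip: "x \<bullet> y = (if x = y then 1 else 0)" if "x \<in> E" "y \<in> E" for x y
    using that orth unit[of x] by (auto simp: pairwise_def orthogonal_def dot_square_norm)
  have Bip: "B x \<bullet> y = (if x = y then l x else 0)" if "x \<in> E" "y \<in> E" for x y
    using that by (simp add: eig ip)
  have C0: "C x \<bullet> x = 0" for x
    using skew[of x x] by simp
  have two: "\<alpha> + \<beta> * (l x * l y) + 3 * \<gamma> * (C x \<bullet> y)\<^sup>2 = 0"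
    if "x \<in> E" "y \<in> E" "x \<noteq> y" for x y
    using rel[of x y y x] that
    by (simp add: R_S_def R_Lambda_def ip Bip C0 skew[of y x] power2_eq_square algebra_simps)
  have three: "(C x \<bullet> y) * (C x \<bullet> z) = 0"
    if "x \<in> E" "y \<in> E" "z \<in> E" "x \<noteq> y" "x \<noteq> z" "y \<noteq> z" for x y z
    using rel[of x y z x] that nz
    by (simp add: R_S_def R_Lambda_def ip Bip C0 skew[of y x] skew[of z x])
  have four: "(C p \<bullet> s) * (C q \<bullet> r) - (C p \<bullet> r) * (C q \<bullet> s) - 2 * (C p \<bullet> q) * (C r \<bullet> s) = 0"
    using rel[of p q r s] mem dist nz by (simp add: R_S_def R_Lambda_def ip Bip)
  have qp: "C q \<bullet> p \<noteq> 0" using pq skew[of q p] by simp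
  have zero: "C p \<bullet> r = 0" "C p \<bullet> s = 0" "C q \<bullet> r = 0" "C q \<bullet> s = 0"
    using three[of p q r] three[of p q s] three[of q p r] three[of q p s] mem dist pq qp by auto
  have "C r \<bullet> s = 0" using four pq zero by simp
  with two[of p r] two[of p s] two[of q r] two[of q s] two[of r s] mem dist zero
  have eqs: "\<alpha> + \<beta> * (l p * l r) = 0" "\<alpha> + \<beta> * (l p * l s) = 0"
    "\<alpha> + \<beta> * (l q * l r) = 0" "\<alpha> + \<beta> * (l r * l s) = 0"
    by auto
  then have nonzero: "\<beta> \<noteq> 0" "l p \<noteq> 0" "l r \<noteq> 0" "l s \<noteq> 0" using nz by auto
  have "\<beta> * (l p * l s) = \<beta> * (l r * l s)" using eqs by linarith
  then have "l p = l r" using nonzero by simp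
  moreover have "\<beta> * (l p * l r) = \<beta> * (l q * l r)" using eqs by linarith
  then have "l p = l q" using nonzero by simp
  ultimately have "\<alpha> + \<beta> * (l p * l q) = 0" using eqs by simp
  with two[of p q] mem dist nz pq show False by auto
qed

lemma linear_zero_if_entries_zero:
  fixes C :: "'a::real_inner \<Rightarrow> 'a"
  assumes C: "linear C" and E: "span E = UNIV"
    and entries: "\<And>x y. x \<in> E \<Longrightarrow> y \<in> E \<Longrightarrow> C x \<bullet> y = 0"
  shows "C = (\<lambda>_. 0)"
proof
  fix v
  have "C x = 0" if x: "x \<in> E" for x
  proof -
    have "subspace {y. C x \<bullet> y = 0}" by (auto simp: subspace_def inner_simps)
    then have "span E \<subseteq> {y. C x \<bullet> y = 0}"
      using entries x by (intro span_minimal) auto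
    then have "C x \<bullet> C x = 0" using E by blast
    then show "C x = 0" by simp
  qed
  then show "C v = 0"
    using linear_eq_0_on_span[OF C, of E v] E by simp
qed

text \<open>
  If every entry of \<open>C\<close> on an orthonormal eigenbasis of \<open>B\<close> vanishes, then \<open>C = 0\<close>; any
  off-diagonal entry extends to a quadruple of distinct basis vectors because the dimension exceeds 3.
\<close>

lemma curvature_relation_forces_skew_map_zero:
  fixes B C :: "'a::euclidean_space \<Rightarrow> 'a"
  assumes B: "linear B" "\<And>x y. B x \<bullet> y = x \<bullet> B y"
    and C: "linear C" "\<And>x y. C x \<bullet> y = - (C y \<bullet> x)"
    and dim: "DIM('a) > 3"
    and rel: "\<And>x y z w. \<alpha> * R_S id x y z w + \<beta> * R_S B x y z w + \<gamma> * R_Lambda C x y z w = 0"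
    and nz: "\<alpha> \<noteq> 0" "\<gamma> \<noteq> 0"
  shows "C = (\<lambda>_. 0)"
proof -
  obtain E l where E: "pairwise orthogonal E" "\<And>e. e \<in> E \<Longrightarrow> norm e = 1"
    "\<And>e. e \<in> E \<Longrightarrow> B e = l e *\<^sub>R e" "span E = UNIV" "finite E" "card E = DIM('a)"
    using selfadjoint_orthonormal_eigenbasis[OF B] by blast
  show ?thesis
  proof (rule linear_zero_if_entries_zero[OF C(1) E(4)])
    fix p q assume pq: "p \<in> E" "q \<in> E"
    show "C p \<bullet> q = 0"
    proof (cases "p = q")
      case True
      then show ?thesis using C(2)[of p p] by simp
    next
      case False
      have "2 \<le> card (E - {p, q})"
        using pq E(5,6) dim False by (simp add: card_Diff_subset)
      then obtain R where "R \<subseteq> E - {p, q}" "card R = 2"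
        by (rule obtain_subset_with_card_n)
      then obtain r s where "r \<in> E - {p, q}" "s \<in> E - {p, q}" "r \<noteq> s"
        by (auto simp: card_2_iff)
      then show ?thesis
        using pq False
        by (intro curvature_relation_forces_skew_entry_zero
            [of \<alpha> \<beta> B \<gamma> C E l p q r s, OF rel nz C(2) E(1-3)]) auto
    qed
  qed
qed

section \<open>Linear independence of the three curvature tensors\<close>

lemma pairs_psubset_lessThan_3: "{0, 1} \<subset> {..<3::nat}" "{1, 2} \<subset> {..<3::nat}"
proof -
  have "2 \<in> {..<3::nat} - {0, 1}" "0 \<in> {..<3::nat} - {1, 2}" by simp_all
  moreover have "{0, 1} \<subseteq> {..<3::nat}" "{1, 2} \<subseteq> {..<3::nat}" by simp_all
  ultimately show "{0, 1} \<subset> {..<3::nat}" "{1, 2} \<subset> {..<3::nat}" by blast+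
qed

theorem theorem4p4:
  fixes B C :: "'a::euclidean_space \<Rightarrow> 'a"
  assumes "linear B" and "linear C"
    and "B = adjoint B" and "C = - adjoint C"
    and "DIM('a) > 3"
    and "\<forall>J. J \<subset> {..<3} \<longrightarrow> independent_family J (\<lambda>i. [R_S id, R_S B, R_Lambda C] ! i)"
    and "independent_family {..<3} (\<lambda>i. [id, B, C] ! i)"
  shows "independent_family {..<3} (\<lambda>i. [R_S id, R_S B, R_Lambda C] ! i)"
proof -
  let ?R = "\<lambda>i. [R_S id, R_S B, R_Lambda C] ! i"
  have three: "{..<3::nat} = {0, 1, 2}" by auto
  have symB: "B x \<bullet> y = x \<bullet> B y" for x y
    using adjoint_works[OF assms(1), of x y] assms(3) by (simp add: inner_commute)
  have skewC: "C x \<bullet> y = - (C y \<bullet> x)" for x y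
  proof -
    have "C x = - adjoint C x" using fun_cong[OF assms(4), of x] by simp
    then show ?thesis
      using adjoint_works[OF assms(2), of y x] by (simp add: inner_commute)
  qed
  have C_nonzero: "C \<noteq> (\<lambda>_. 0)"
  proof
    assume "C = (\<lambda>_. 0)"
    then have "(0 :: 'a \<Rightarrow> 'a) \<in> (\<lambda>i. [id, B, C] ! i) ` {..<3}"
      by (auto simp: three zero_fun_def)
    then show False
      using assms(7) dependent_zero[of "(\<lambda>i. [id, B, C] ! i) ` {..<3}"]
      by (simp add: independent_family_def)
  qed
  have proper: "\<forall>i\<in>J. c i = 0" if "J \<subset> {..<3}" "(\<Sum>i\<in>J. c i *\<^sub>R ?R i) = 0" for J c
  proof -
    have "finite J" using that(1) finite_subset by blast
    then have "\<forall>c. (\<Sum>i\<in>J. c i *\<^sub>R ?R i) = 0 \<longrightarrow> (\<forall>i\<in>J. c i = 0)"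
      using assms(6) that(1) by (simp only: independent_family_iff[symmetric])
    from this[THEN spec, of c] that(2) show ?thesis by (rule mp)
  qed
  show ?thesis
    unfolding independent_family_iff[OF finite_lessThan]
  proof (intro allI impI)
    fix c :: "nat \<Rightarrow> real"
    assume "(\<Sum>i<3. c i *\<^sub>R ?R i) = 0"
    then have sum0: "c 0 *\<^sub>R R_S id + (c 1 *\<^sub>R R_S B + c 2 *\<^sub>R R_Lambda C) = 0"
      by (simp add: three)
    have rel: "c 0 * R_S id x y z w + c 1 * R_S B x y z w + c 2 * R_Lambda C x y z w = 0"
      for x y z w
      using sum0 by (simp add: fun_eq_iff scaleR_fun_def add.assoc)
    consider "c 2 = 0" | "c 0 = 0" | "c 0 \<noteq> 0" "c 2 \<noteq> 0" by blast
    then show "\<forall>i\<in>{..<3}. c i = 0"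
    proof cases
      case 1
      then have "(\<Sum>i\<in>{0, 1}. c i *\<^sub>R ?R i) =
        c 0 *\<^sub>R R_S id + (c 1 *\<^sub>R R_S B + c 2 *\<^sub>R R_Lambda C)" by simp
      then have "(\<Sum>i\<in>{0, 1}. c i *\<^sub>R ?R i) = 0" using sum0 by (rule trans)
      then have "\<forall>i\<in>{0, 1}. c i = 0"
        by (rule proper[OF pairs_psubset_lessThan_3(1)])
      with 1 show ?thesis unfolding three by simp
    next
      case 2
      then have "(\<Sum>i\<in>{1, 2}. c i *\<^sub>R ?R i) =
        c 0 *\<^sub>R R_S id + (c 1 *\<^sub>R R_S B + c 2 *\<^sub>R R_Lambda C)" by simp
      then have "(\<Sum>i\<in>{1, 2}. c i *\<^sub>R ?R i) = 0" using sum0 by (rule trans)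
      then have "\<forall>i\<in>{1, 2}. c i = 0"
        by (rule proper[OF pairs_psubset_lessThan_3(2)])
      with 2 show ?thesis unfolding three by simp
    next
      case 3
      have "C = (\<lambda>_. 0)"
        by (rule curvature_relation_forces_skew_map_zero[of B C "c 0" "c 1" "c 2"])
          (fact assms(1) symB assms(2) skewC assms(5) rel 3)+
      with C_nonzero show ?thesis by contradiction
    qed
  qed
qed

end
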